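(* The set $\lambda(\mathcal{S}^{4,2})$ is the basic semialgebraic set consisting of all $\lambda\in\mathbb{R}^4$ satisfying $$e_1(\lambda)\ge 0,\qquad e_2(\lambda)\ge 0,\qquad e_2(\lambda)^2\ge 4e_4(\lambda).$$
   Context: $\mathcal{S}^{4,2}$ is the set of real symmetric $4\times 4$ matrices all of whose $2\times 2$ principal submatrices are positive semidefinite. $\lambda(\mathcal{S}^{4,2})$ is the set of all $(\lambda_1,\lambda_2,\lambda_3,\lambda_4)\in\mathbb{R}^4$ such that some $X\in\mathcal{S}^{4,2}$ is similar to $\operatorname{diag}(\lambda_1,\lambda_2,\lambda_3,\lambda_4)$ (so it consists of all orderings of the eigenvalues, with multiplicity, of matrices in $\mathcal{S}^{4,2}$). $e_k$ denotes the $k$-th elementary symmetric polynomial in four variables. *)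

theory Defs
  imports "HOL-Analysis.Analysis"
begin

definition positive_semidefinite :: "real^'n^'n \<Rightarrow> bool" where
  "positive_semidefinite A \<longleftrightarrow> transpose A = A \<and> (\<forall>x. 0 \<le> x \<bullet> (A *v x))"

text \<open>
  The principal submatrix of \<open>A\<close> with rows and columns \<open>f 0 < f 1 < \<dots>\<close>; the index set is
  presented by a strictly increasing enumeration \<open>f\<close>, so a \<open>k \<times> k\<close> principal submatrix
  is one with \<open>CARD('k) = k\<close>.
\<close>

definition principal_submatrix :: "('k \<Rightarrow> 'n) \<Rightarrow> 'a^'n^'n \<Rightarrow> 'a^'k^'k" where
  "principal_submatrix f A = (\<chi> i j. A $ f i $ f j)"

definition S42 :: "(real^4^4) set" where
  "S42 = {X. transpose X = X \<and>
     (\<forall>f :: 2 \<Rightarrow> 4. strict_mono f \<longrightarrow> positive_semidefinite (principal_submatrix f X))}"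

definition diag :: "'a::zero^'n \<Rightarrow> 'a^'n^'n" where
  "diag v = (\<chi> i j. if i = j then v $ i else 0)"

definition similar_matrices :: "'a::field^'n^'n \<Rightarrow> 'a^'n^'n \<Rightarrow> bool" where
  "similar_matrices A B \<longleftrightarrow> (\<exists>P. invertible P \<and> A = P ** B ** matrix_inv P)"

definition spectra :: "(real^'n^'n) set \<Rightarrow> (real^'n) set" where
  "spectra S = {v. \<exists>X\<in>S. similar_matrices X (diag v)}"

definition elem_sym :: "nat \<Rightarrow> 'a::comm_ring_1^'n \<Rightarrow> 'a" where
  "elem_sym k v = (\<Sum>I | card I = k. \<Prod>i\<in>I. v $ i)"

end

theory Submission
  imports Defs "HOL-Combinatorics.Permutations" "HOL-Computational_Algebra.Polynomial"
begin

text \<open>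
  Write \<open>M\<^sub>i\<^sub>j\<close> for the principal minor \<open>X\<^sub>i\<^sub>i X\<^sub>j\<^sub>j - X\<^sub>i\<^sub>j\<^sup>2\<close>. A symmetric matrix is in \<open>S42\<close> exactly if its diagonal
  and all \<open>M\<^sub>i\<^sub>j\<close> are nonnegative (\<open>S42_iff\<close>).

  \<^emph>\<open>The inequalities are necessary.\<close> The trace \<open>e\<^sub>1\<close> and the sum \<open>e\<^sub>2\<close> of the \<open>M\<^sub>i\<^sub>j\<close> are nonnegative. The third
  inequality rests on the estimate \<open>det X \<le> M\<^sub>1\<^sub>2 M\<^sub>3\<^sub>4 + M\<^sub>1\<^sub>3 M\<^sub>2\<^sub>4 + M\<^sub>1\<^sub>4 M\<^sub>2\<^sub>3\<close> (\<open>S42_det_le\<close>). After scaling rows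
  and columns so that the diagonal consists of ones, the off-diagonal entries range over the cube \<open>[-1,1]\<^sup>6\<close>, and all
  terms containing squares cancel. What remains is affine in each entry
  separately, so that only vertices of the cube matter; the expression factors there
  (\<open>triangles_le_quadrilaterals\<close>). Since \<open>(x + y)\<^sup>2 \<ge> 4 x y\<close>, the square of \<open>e\<^sub>2\<close> is at least four times the
  right-hand side of the estimate.

  \<^emph>\<open>The inequalities are sufficient.\<close> The spectrum of a symmetric matrix can be read off from its characteristic
  polynomial, by the spectral theorem, so it is enough to exhibit matrices in \<open>S42\<close> with the right characteristic
  polynomials. Nonnegative spectra are realized by diagonal matrices, and the inequalities exclude three or
  more negative eigenvalues.

  Let there be one negative eigenvalue. Since \<open>S42\<close> is closed under adding positive semidefinite matrices, it
  suffices to realize the spectrum in which that eigenvalue is lowered until \<open>e\<^sub>2 = 0\<close> (\<open>S42_char_roots_mono\<close>). Then all \<open>M\<^sub>i\<^sub>j\<close> have to vanish, and a matrix with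
  entries \<open>v\<^sub>i\<^sup>2\<close> on and \<open>- v\<^sub>i v\<^sub>j\<close> off the diagonal works (\<open>S42_char_roots_one_negative_extreme\<close>).

  Let the eigenvalues be \<open>a, b, -c, -d\<close> with two negative ones. The condition \<open>e\<^sub>2 \<ge> 2 \<surd>e\<^sub>4\<close> is equivalent to
  \<open>(a - c) (b - d) \<ge> (\<surd>(a c) + \<surd>(b d))\<^sup>2\<close>. This form suggests pairing the eigenvalues as \<open>a, -c\<close> and \<open>b, -d\<close>, and
  there is a matrix that decouples into two blocks with these eigenvalues
  (\<open>S42_char_roots_two_negative\<close>).
\<close>

section \<open>Matrices and vectors of size four\<close>

lemma det_4:
  fixes A :: "'a::comm_ring_1^4^4"
  shows "det A =
      A$1$1 * A$2$2 * A$3$3 * A$4$4 - A$1$1 * A$2$2 * A$3$4 * A$4$3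
    - A$1$1 * A$2$3 * A$3$2 * A$4$4 + A$1$1 * A$2$3 * A$3$4 * A$4$2
    + A$1$1 * A$2$4 * A$3$2 * A$4$3 - A$1$1 * A$2$4 * A$3$3 * A$4$2
    - A$1$2 * A$2$1 * A$3$3 * A$4$4 + A$1$2 * A$2$1 * A$3$4 * A$4$3
    + A$1$2 * A$2$3 * A$3$1 * A$4$4 - A$1$2 * A$2$3 * A$3$4 * A$4$1
    - A$1$2 * A$2$4 * A$3$1 * A$4$3 + A$1$2 * A$2$4 * A$3$3 * A$4$1
    + A$1$3 * A$2$1 * A$3$2 * A$4$4 - A$1$3 * A$2$1 * A$3$4 * A$4$2
    - A$1$3 * A$2$2 * A$3$1 * A$4$4 + A$1$3 * A$2$2 * A$3$4 * A$4$1
    + A$1$3 * A$2$4 * A$3$1 * A$4$2 - A$1$3 * A$2$4 * A$3$2 * A$4$1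
    - A$1$4 * A$2$1 * A$3$2 * A$4$3 + A$1$4 * A$2$1 * A$3$3 * A$4$2
    + A$1$4 * A$2$2 * A$3$1 * A$4$3 - A$1$4 * A$2$2 * A$3$3 * A$4$1
    - A$1$4 * A$2$3 * A$3$1 * A$4$2 + A$1$4 * A$2$3 * A$3$2 * A$4$1"
proof -
  have f: "finite {2, 3, 4::4}" "1 \<notin> {2, 3, 4::4}" "finite {3, 4::4}" "2 \<notin> {3, 4::4}"
    "finite {4::4}" "3 \<notin> {4::4}"
    by auto
  show ?thesis
    unfolding det_def UNIV_4
    unfolding sum_over_permutations_insert[OF f(1,2)]
    unfolding sum_over_permutations_insert[OF f(3,4)]
    unfolding sum_over_permutations_insert[OF f(5,6)]
    unfolding permutes_sing
    by (simp add: sign_swap_id permutation_swap_id permutation_compose sign_compose sign_id swap_id_eq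
        algebra_simps)
qed

lemma vector_4 [simp]:
  "(vector [a,b,c,d] :: 'a::zero^4)$1 = a" "(vector [a,b,c,d] :: 'a::zero^4)$2 = b"
  "(vector [a,b,c,d] :: 'a::zero^4)$3 = c" "(vector [a,b,c,d] :: 'a::zero^4)$4 = d"
  by (simp_all add: vector_def)

lemma prod_4: "prod f (UNIV::4 set) = f 1 * f 2 * f 3 * f 4"
  unfolding UNIV_4 by (simp add: ac_simps)

lemma elem_sym_4:
  fixes v :: "'a::comm_ring_1^4"
  shows "elem_sym 1 v = v$1 + v$2 + v$3 + v$4"
    "elem_sym 2 v = v$1 * v$2 + v$1 * v$3 + v$1 * v$4 + v$2 * v$3 + v$2 * v$4 + v$3 * v$4"
    "elem_sym 4 v = v$1 * v$2 * v$3 * v$4"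
proof -
  have 1: "{I::4 set. card I = 1} = {{1},{2},{3},{4}}"
    using exhaust_4 by (auto simp: card_1_singleton_iff)
  have 2: "{I::4 set. card I = 2} = {{1,2},{1,3},{1,4},{2,3},{2,4},{3,4}}" (is "?L = ?R")
  proof
    show "?L \<subseteq> ?R"
    proof
      fix I :: "4 set"
      assume "I \<in> ?L"
      then obtain i j where ij: "I = {i, j}" "i \<noteq> j"
        by (auto simp: card_2_iff)
      then show "I \<in> ?R"
        using exhaust_4[of i] exhaust_4[of j] by (elim disjE) (simp_all add: insert_commute)
    qed
  qed auto
  have 4: "{I::4 set. card I = 4} = {UNIV}"
    using card_subset_eq[of "UNIV :: 4 set"] by auto
  show "elem_sym 1 v = v$1 + v$2 + v$3 + v$4"
    unfolding elem_sym_def 1 by (simp add: algebra_simps)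
  show "elem_sym 2 v = v$1 * v$2 + v$1 * v$3 + v$1 * v$4 + v$2 * v$3 + v$2 * v$4 + v$3 * v$4"
    unfolding elem_sym_def 2 by (simp add: algebra_simps doubleton_eq_iff)
  show "elem_sym 4 v = v$1 * v$2 * v$3 * v$4"
    unfolding elem_sym_def 4 by (simp add: prod_4)
qed

section \<open>Entrywise description of the cone\<close>

text \<open>
  After multiplication by \<open>a\<close> the form is \<open>(a x + b y)\<^sup>2 + (a d - b\<^sup>2) y\<^sup>2\<close>, which settles the
  case \<open>a > 0\<close>; for \<open>a = 0\<close> a nonzero \<open>b\<close> would make the form change sign.
\<close>

lemma quadratic_form_2_nonneg_iff:
  fixes a b d :: real
  shows "(\<forall>x y. 0 \<le> a * x\<^sup>2 + 2 * b * x * y + d * y\<^sup>2) \<longleftrightarrow> 0 \<le> a \<and> 0 \<le> d \<and> b\<^sup>2 \<le> a * d"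
    (is "?L \<longleftrightarrow> ?R")
proof
  assume L: ?L
  have a: "0 \<le> a" using L[rule_format, of 1 0] by simp
  have d: "0 \<le> d" using L[rule_format, of 0 1] by simp
  have "0 \<le> a * (a * d - b\<^sup>2)"
    using L[rule_format, of "- b" a] by (simp add: algebra_simps power2_eq_square)
  moreover have "b = 0" if "a = 0"
  proof -
    have "0 \<le> - ((d + 2) * b\<^sup>2)"
      using L[rule_format, of "-(d + 1)" b] that by (simp add: algebra_simps power2_eq_square)
    then have "(d + 2) * b\<^sup>2 = 0"
      using d by (intro antisym) auto
    then show ?thesis
      using d by simp
  qed
  ultimately show ?R
    using a d by (cases "a = 0") (auto simp: zero_le_mult_iff)
next
  assume R: ?R
  show ?L
  proof (intro allI)
    fix x y :: real
    show "0 \<le> a * x\<^sup>2 + 2 * b * x * y + d * y\<^sup>2"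
    proof (cases "a = 0")
      case True
      then show ?thesis using R by simp
    next
      case False
      then have "a > 0" using R by simp
      have "a * (a * x\<^sup>2 + 2 * b * x * y + d * y\<^sup>2) = (a * x + b * y)\<^sup>2 + (a * d - b\<^sup>2) * y\<^sup>2"
        by (simp add: algebra_simps power2_eq_square)
      also have "\<dots> \<ge> 0" using R by simp
      finally show ?thesis using \<open>a > 0\<close> by (simp add: zero_le_mult_iff)
    qed
  qed
qed

lemma positive_semidefinite_2_iff:
  fixes A :: "real^2^2"
  shows "positive_semidefinite A \<longleftrightarrow>
    A$1$2 = A$2$1 \<and> 0 \<le> A$1$1 \<and> 0 \<le> A$2$2 \<and> (A$1$2)\<^sup>2 \<le> A$1$1 * A$2$2"
proof -
  have *: "x \<bullet> (A *v x) = A$1$1 * (x$1)\<^sup>2 + 2 * A$1$2 * x$1 * x$2 + A$2$2 * (x$2)\<^sup>2"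
    if "A$1$2 = A$2$1" for x
    using that by (simp add: inner_vec_def matrix_vector_mult_def sum_2 algebra_simps power2_eq_square)
  have "(\<forall>x::real^2. P (x$1) (x$2)) \<longleftrightarrow> (\<forall>x y. P x y)" for P :: "real \<Rightarrow> real \<Rightarrow> bool"
    by (metis vector_2)
  from this[of "\<lambda>x y. 0 \<le> A$1$1 * x\<^sup>2 + 2 * A$1$2 * x * y + A$2$2 * y\<^sup>2"]
  have "(\<forall>x. 0 \<le> x \<bullet> (A *v x)) \<longleftrightarrow> 0 \<le> A$1$1 \<and> 0 \<le> A$2$2 \<and> (A$1$2)\<^sup>2 \<le> A$1$1 * A$2$2"
    if "A$1$2 = A$2$1"
    unfolding *[OF that] quadratic_form_2_nonneg_iff .
  moreover have "transpose A = A \<longleftrightarrow> A$1$2 = A$2$1"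
    by (auto simp: transpose_def vec_eq_iff forall_2)
  ultimately show ?thesis
    unfolding positive_semidefinite_def by blast
qed

text \<open>
  Every pair \<open>i \<noteq> j\<close> is the range of exactly one strictly increasing enumeration, so the condition on
  submatrices is a condition on the entries at all pairs. This is the form in which membership is used.
\<close>

lemma S42_iff:
  "X \<in> S42 \<longleftrightarrow> transpose X = X \<and> (\<forall>i. 0 \<le> X$i$i) \<and> (\<forall>i j. (X$i$j)\<^sup>2 \<le> X$i$i * X$j$j)"
proof -
  \<comment> \<open>in the type \<open>2\<close> the numeral \<open>2\<close> denotes the residue \<open>0\<close>, the least element\<close>
  have 2: "(0::2) = 2" "(1::2) \<noteq> 2"
    by simp_all
  have "(0::2) < 1"
    by (simp add: less_bit0_def bit0.Rep_0 bit0.Rep_1)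
  then have lt: "(2::2) < 1"
    unfolding 2(1) .
  have sub: "positive_semidefinite (principal_submatrix f X) \<longleftrightarrow>
      0 \<le> X$f 1$f 1 \<and> 0 \<le> X$f 2$f 2 \<and> (X$f 1$f 2)\<^sup>2 \<le> X$f 1$f 1 * X$f 2$f 2"
    if "transpose X = X" for f :: "2 \<Rightarrow> 4"
    using that by (auto simp: positive_semidefinite_2_iff principal_submatrix_def transpose_def vec_eq_iff)
  have ex: "\<exists>f :: 2 \<Rightarrow> 4. strict_mono f \<and> f 2 = i \<and> f 1 = j" if "i < j" for i j :: 4
  proof (intro exI conjI)
    show "strict_mono (\<lambda>k::2. if k = 1 then j else i)"
    proof (rule strict_monoI)
      fix k l :: 2
      assume "k < l"
      then have "k = 2" "l = 1"
        using exhaust_2[of k] exhaust_2[of l] lt by auto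
      then show "(if k = 1 then j else i) < (if l = 1 then j else i)"
        using that by simp
    qed
  qed auto
  show ?thesis
  proof
    assume X: "X \<in> S42"
    then have t: "transpose X = X" by (simp add: S42_def)
    have sym: "X$i$j = X$j$i" for i j
      using arg_cong[OF t, of "\<lambda>M. M$j$i"] by (simp add: transpose_def)
    have lt: "0 \<le> X$i$i \<and> 0 \<le> X$j$j \<and> (X$i$j)\<^sup>2 \<le> X$i$i * X$j$j" if "i < j" for i j
      using ex[OF that] X sub[OF t] by (auto simp: S42_def sym[of i j] mult.commute)
    have ne: "0 \<le> X$i$i \<and> (X$i$j)\<^sup>2 \<le> X$i$i * X$j$j" if "i \<noteq> j" for i j
      using lt[of i j] lt[of j i] that by (auto simp: sym[of i j] mult.commute neq_iff)
    have "\<exists>j. j \<noteq> i" for i :: 4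
      using exhaust_4[of i] by (metis (mono_tags) zero_neq_one)
    then have "0 \<le> X$i$i" for i
      using ne by metis
    moreover have "(X$i$j)\<^sup>2 \<le> X$i$i * X$j$j" for i j
      using ne[of i j] by (cases "i = j") (auto simp: power2_eq_square)
    ultimately show "transpose X = X \<and> (\<forall>i. 0 \<le> X$i$i) \<and> (\<forall>i j. (X$i$j)\<^sup>2 \<le> X$i$i * X$j$j)"
      using t by blast
  next
    assume "transpose X = X \<and> (\<forall>i. 0 \<le> X$i$i) \<and> (\<forall>i j. (X$i$j)\<^sup>2 \<le> X$i$i * X$j$j)"
    then show "X \<in> S42"
      by (simp add: S42_def sub)
  qed
qed

section \<open>The spectral theorem for real symmetric matrices\<close>

lemma matrix_add_rdistrib:
  fixes A B :: "'a::semiring_1^'n^'m" and C :: "'a^'p^'n"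
  shows "(A + B) ** C = A ** C + B ** C"
  by (vector matrix_matrix_mult_def sum.distrib[symmetric] field_simps)

lemma symmetric_matrix_inner:
  fixes A :: "real^'n^'n"
  assumes "transpose A = A"
  shows "x \<bullet> (A *v y) = (A *v x) \<bullet> y"
  by (metis assms dot_lmul_matrix transpose_matrix_vector)

text \<open>
  A maximum point \<open>v\<close> of the quadratic form on the unit sphere of \<open>S\<close> is an eigenvector. The residual
  \<open>y = A v - \<mu> v\<close> lies in \<open>S\<close>; moving from \<open>v\<close> by \<open>t y\<close> changes the form minus \<open>\<mu>\<close> times the squared
  norm by \<open>2 t (y \<bullet> y)\<close> to first order, and maximality forces \<open>y = 0\<close>.
\<close>

lemma symmetric_eigenvector_in_subspace:
  fixes A :: "real^'n^'n" and S :: "(real^'n) set"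
  assumes sym: "transpose A = A" and S: "subspace S" and inv: "\<And>x. x \<in> S \<Longrightarrow> A *v x \<in> S"
    and nz: "z \<in> S" "z \<noteq> 0"
  obtains v \<mu> where "v \<in> S" "norm v = 1" "A *v v = \<mu> *\<^sub>R v"
proof -
  let ?q = "\<lambda>x. x \<bullet> (A *v x)"
  have "compact (sphere 0 1 \<inter> S)"
    by (intro compact_Int_closed closed_subspace S) simp
  moreover have "z /\<^sub>R norm z \<in> sphere 0 1 \<inter> S"
    using nz S by (simp add: subspace_scale)
  moreover have "continuous_on (sphere 0 1 \<inter> S) ?q"
    by (intro continuous_intros matrix_vector_mult_linear_continuous_on)
  ultimately obtain v where v: "v \<in> S" "norm v = 1"
    and max: "\<And>x. x \<in> S \<Longrightarrow> norm x = 1 \<Longrightarrow> ?q x \<le> ?q v"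
    using continuous_attains_sup[of "sphere 0 1 \<inter> S" ?q] by (metis (lifting) IntE IntI empty_iff mem_sphere_0)
  define \<mu> where "\<mu> = ?q v"
  have le: "?q x \<le> \<mu> * (x \<bullet> x)" if "x \<in> S" for x
  proof (cases "x = 0")
    case False
    have "?q (x /\<^sub>R norm x) \<le> \<mu>"
      unfolding \<mu>_def using that False S by (intro max) (auto simp: subspace_scale)
    moreover have "?q x = (x \<bullet> x) * ?q (x /\<^sub>R norm x)"
      using False by (simp add: matrix_vector_mult_scaleR dot_square_norm power2_eq_square field_simps)
    ultimately show ?thesis
      by (metis inner_ge_zero mult.commute mult_right_mono)
  qed simp
  define y where "y = A *v v - \<mu> *\<^sub>R v"
  have y: "y \<in> S"
    unfolding y_def using v S inv by (intro subspace_diff subspace_scale) auto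
  define K where "K = \<mu> * (y \<bullet> y) - ?q y"
  have K: "0 \<le> K" unfolding K_def using le[OF y] by simp
  have key: "2 * t * (y \<bullet> y) \<le> t\<^sup>2 * K" for t
  proof -
    have "?q (v + t *\<^sub>R y) \<le> \<mu> * ((v + t *\<^sub>R y) \<bullet> (v + t *\<^sub>R y))"
      using y v S by (intro le subspace_add subspace_scale) auto
    moreover have "?q (v + t *\<^sub>R y) = \<mu> + 2 * t * (y \<bullet> (A *v v)) + t\<^sup>2 * ?q y"
      using symmetric_matrix_inner[OF sym, of v y]
      by (simp add: \<mu>_def matrix_vector_mult_scaleR matrix_vector_right_distrib inner_add_left
          inner_add_right inner_commute[of "A *v v"] algebra_simps power2_eq_square)
    moreover have "(v + t *\<^sub>R y) \<bullet> (v + t *\<^sub>R y) = 1 + 2 * t * (y \<bullet> v) + t\<^sup>2 * (y \<bullet> y)"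
      using v by (simp add: inner_add_left inner_add_right inner_commute[of v y] algebra_simps
          power2_eq_square flip: norm_eq_1)
    ultimately have "\<mu> + 2 * t * (y \<bullet> (A *v v)) + t\<^sup>2 * ?q y
        \<le> \<mu> * (1 + 2 * t * (y \<bullet> v) + t\<^sup>2 * (y \<bullet> y))"
      by (simp only:)
    moreover have yy: "y \<bullet> y = y \<bullet> (A *v v) - \<mu> * (y \<bullet> v)"
      by (metis inner_diff_right inner_scaleR_right y_def)
    have "2 * t * (y \<bullet> y) = 2 * t * (y \<bullet> (A *v v)) - \<mu> * (2 * t * (y \<bullet> v))"
      unfolding yy by (simp add: algebra_simps)
    ultimately show ?thesis
      unfolding K_def right_diff_distrib distrib_left by (simp only: mult.left_commute[of \<mu>])
  qed
  have "y \<bullet> y \<le> 0"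
  proof (rule ccontr)
    assume "\<not> y \<bullet> y \<le> 0"
    then have p: "0 < y \<bullet> y" by (simp only: not_le)
    \<comment> \<open>a step so small that the first-order gain beats the second-order loss \<open>t\<^sup>2 K\<close>\<close>
    define t where "t = (y \<bullet> y) / (K + 1)"
    have t: "0 < t" "t * K < y \<bullet> y"
      using p K by (auto simp: t_def field_simps)
    then have "t * (t * K) < t * (2 * (y \<bullet> y))"
      using p by (intro mult_strict_left_mono) linarith+
    then show False
      using key[of t] by (simp add: power2_eq_square algebra_simps)
  qed
  then have "y = 0"
    by (metis inner_gt_zero_iff not_le)
  then show thesis
    using that v by (simp add: y_def)
qed

text \<open>
  Orthonormal families of eigenvectors can be enlarged one vector at a time: the orthogonal complement
  of such a family is invariant, because the matrix is symmetric, and it therefore contains a further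
  eigenvector as long as the family is smaller than the dimension.
\<close>

lemma symmetric_matrix_orthogonal_diagonalization:
  fixes A :: "real^'n^'n"
  assumes sym: "transpose A = A"
  obtains Q :: "real^'n^'n" and \<mu> where "orthogonal_matrix Q" "A = Q ** diag \<mu> ** transpose Q"
proof -
  have "\<exists>B. finite B \<and> card B = k \<and> pairwise orthogonal B \<and> (\<forall>v\<in>B. norm v = 1 \<and> (\<exists>\<mu>. A *v v = \<mu> *\<^sub>R v))"
    if "k \<le> CARD('n)" for k
    using that
  proof (induction k)
    case (Suc k)
    then obtain B where B: "finite B" "card B = k" "pairwise orthogonal B"
      "\<And>v. v \<in> B \<Longrightarrow> norm v = 1" "\<And>v. v \<in> B \<Longrightarrow> \<exists>\<mu>. A *v v = \<mu> *\<^sub>R v"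
      by auto
    define S where "S = {x. \<forall>b\<in>B. orthogonal b x}"
    have "dim B < DIM(real^'n)"
      using dim_le_card[of B B] B Suc.prems by (auto simp: span_superset)
    then obtain z where "z \<noteq> 0" "\<And>y. y \<in> span B \<Longrightarrow> orthogonal z y"
      using orthogonal_to_subspace_exists by blast
    then have z: "z \<in> S" "z \<noteq> 0"
      by (auto simp: S_def span_base orthogonal_commute)
    have S: "subspace S"
      by (auto simp: S_def subspace_def orthogonal_def inner_add_right)
    have inv: "A *v x \<in> S" if "x \<in> S" for x
      using that B(5) by (fastforce simp: S_def orthogonal_def symmetric_matrix_inner[OF sym])
    obtain v \<mu> where v: "v \<in> S" "norm v = 1" "A *v v = \<mu> *\<^sub>R v"
      using symmetric_eigenvector_in_subspace[OF sym S inv z] by metis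
    have "v \<notin> B"
      using v by (auto simp: S_def orthogonal_self)
    then show ?case
      using v B by (intro exI[of _ "insert v B"]) (auto simp: pairwise_insert S_def orthogonal_commute)
  next
    case 0
    show ?case
      by (intro exI[of _ "{}"]) simp
  qed
  from this[OF order_refl] obtain B where B: "finite B" "card B = CARD('n)" "pairwise orthogonal B"
      "\<And>v. v \<in> B \<Longrightarrow> norm v = 1" "\<And>v. v \<in> B \<Longrightarrow> \<exists>\<mu>. A *v v = \<mu> *\<^sub>R v"
    by auto
  obtain f :: "'n \<Rightarrow> real^'n" where f: "bij_betw f UNIV B"
    using B finite_same_card_bij[of "UNIV :: 'n set" B] by auto
  then have fB: "f i \<in> B" for i
    by (auto simp: bij_betw_def)
  obtain \<mu> where \<mu>: "\<And>i. A *v f i = \<mu> i *\<^sub>R f i"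
    using B(5)[OF fB] by metis
  define Q :: "real^'n^'n" where "Q = (\<chi> i j. f j $ i)"
  have col: "column i Q = f i" for i
    by (simp add: column_def Q_def vec_eq_iff)
  have "orthogonal_matrix Q"
    unfolding orthogonal_matrix_orthonormal_columns col
    using B(3) B(4)[OF fB] fB bij_betw_imp_inj_on[OF f] by (metis injD pairwise_def)
  moreover have "A ** Q = Q ** diag (\<chi> i. \<mu> i)"
  proof -
    have "(A ** Q) $ i $ j = (A *v f j) $ i" for i j
      by (simp add: matrix_matrix_mult_def matrix_vector_mult_def Q_def)
    moreover have "(Q ** diag (\<chi> i. \<mu> i)) $ i $ j = (\<mu> j *\<^sub>R f j) $ i" for i j
      by (simp add: matrix_matrix_mult_def Q_def diag_def if_distrib cong: if_cong)
    ultimately show ?thesis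
      by (simp add: vec_eq_iff \<mu>)
  qed
  moreover have "A = A ** Q ** transpose Q" if "orthogonal_matrix Q"
    using that by (simp add: orthogonal_matrix_def flip: matrix_mul_assoc)
  ultimately show thesis
    using that by metis
qed

text \<open>
  Both products are the same polynomial, so the multisets of roots agree.
\<close>

lemma prod_linear_factors_eq_imp_permutes:
  fixes \<nu> \<mu> :: "'n::finite \<Rightarrow> real"
  assumes "\<And>x. (\<Prod>i\<in>UNIV. x - \<mu> i) = (\<Prod>i\<in>UNIV. x - \<nu> i)"
  obtains p where "p permutes UNIV" "\<And>i. \<mu> i = \<nu> (p i)"
proof -
  have "poly (\<Prod>i\<in>UNIV. [:- \<mu> i, 1:]) x = poly (\<Prod>i\<in>UNIV. [:- \<nu> i, 1:]) x" for x
    using assms[of x] by (simp add: poly_prod)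
  then have "(\<Prod>i\<in>UNIV. [:- \<mu> i, 1:]) = (\<Prod>i\<in>UNIV. [:- \<nu> i, 1:])"
    by (subst poly_eq_poly_eq_iff[symmetric]) (rule ext)
  moreover have "proots (\<Prod>i\<in>UNIV. [:- h i, 1:]) = image_mset h (mset_set UNIV)" for h :: "'n \<Rightarrow> real"
    by (subst proots_prod) (simp_all add: sum_unfold_sum_mset)
  ultimately have "image_mset \<mu> (mset_set UNIV) = image_mset \<nu> (mset_set UNIV)"
    by metis
  then show thesis
    using image_mset_eq_implies_permutes[of "UNIV::'n set" \<mu> \<nu>] that by auto
qed

lemma det_diag: "det (diag v) = (\<Prod>i\<in>UNIV. v$i)"
  by (subst det_diagonal) (auto simp: diag_def)

lemma char_poly_orthogonal_conj_diag:
  fixes Q :: "real^'n^'n"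
  assumes Q: "orthogonal_matrix Q"
  shows "det (mat x - Q ** diag w ** transpose Q) = (\<Prod>i\<in>UNIV. x - w$i)"
proof -
  have QQ: "Q ** transpose Q = mat 1"
    using Q by (auto simp: orthogonal_matrix_def)
  have "Q ** mat x = x *\<^sub>R Q"
    by (simp add: matrix_matrix_mult_def mat_def vec_eq_iff if_distrib mult.commute cong: if_cong)
  then have "Q ** mat x ** transpose Q = mat x"
    using QQ by (simp add: scalar_matrix_assoc[symmetric]) (simp add: mat_def vec_eq_iff)
  then have "Q ** (mat x - diag w) ** transpose Q + Q ** diag w ** transpose Q = mat x"
    by (simp flip: matrix_add_ldistrib matrix_add_rdistrib)
  then have "mat x - Q ** diag w ** transpose Q = Q ** (mat x - diag w) ** transpose Q"
    by (simp add: algebra_simps)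
  moreover have "mat x - diag w = diag (\<chi> i. x - w$i)"
    by (simp add: vec_eq_iff diag_def mat_def)
  moreover have "det Q * det (transpose Q) = 1"
    by (metis QQ det_I det_mul)
  ultimately show ?thesis
    by (simp add: det_mul det_diag)
qed

text \<open>
  The eigenvalues may be placed on the diagonal in any prescribed order. So a matrix with a given
  spectrum can be found by computing a characteristic polynomial, without computing eigenvectors.
\<close>

lemma char_poly_splits_imp_orthogonally_similar:
  fixes A :: "real^'n^'n"
  assumes sym: "transpose A = A" and ch: "\<And>x. det (mat x - A) = (\<Prod>i\<in>UNIV. x - v$i)"
  obtains Q where "orthogonal_matrix Q" "A = Q ** diag v ** transpose Q"
proof -
  obtain Q :: "real^'n^'n" and w where Q: "orthogonal_matrix Q" and A: "A = Q ** diag w ** transpose Q"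
    using symmetric_matrix_orthogonal_diagonalization[OF sym] .
  have "(\<Prod>i\<in>UNIV. x - w$i) = (\<Prod>i\<in>UNIV. x - v$i)" for x
    using ch[of x] unfolding A char_poly_orthogonal_conj_diag[OF Q] .
  then obtain p where p: "p permutes UNIV" "\<And>i. w$i = v$(p i)"
    using prod_linear_factors_eq_imp_permutes[of "($) w" "($) v"] by auto
  define R where "R = (\<chi> i j. Q $ i $ inv p j)"
  have "orthogonal_matrix R"
    using Q permutes_inj[OF permutes_inv[OF p(1)]]
    unfolding orthogonal_matrix_orthonormal_columns
    by (simp add: R_def column_def inj_eq)
  moreover have "A = R ** diag v ** transpose R"
  proof -
    have "(R ** diag v ** transpose R) $ i $ j = (\<Sum>k\<in>UNIV. Q $ i $ inv p k * v$k * Q $ j $ inv p k)" for i j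
      by (simp add: matrix_matrix_mult_def transpose_def R_def diag_def if_distrib cong: if_cong)
    also have "\<dots> i j = (\<Sum>k\<in>UNIV. Q $ i $ k * w$k * Q $ j $ k)" for i j
      using p by (subst sum.permute[OF p(1)]) (simp add: permutes_inverses)
    finally show ?thesis
      by (simp add: A vec_eq_iff) (simp add: matrix_matrix_mult_def transpose_def diag_def if_distrib cong: if_cong)
  qed
  ultimately show thesis using that by blast
qed

section \<open>Necessity of the inequalities\<close>

text \<open>
  Label the edges of the complete graph on four vertices so that \<open>a, a'\<close> and \<open>b, b'\<close> and \<open>c, c'\<close> are the
  three pairs of opposite edges. On the left are the products over the four triangles, on the right,
  besides \<open>1\<close>, the products over the three four-cycles. The difference is affine in each variable, so
  it suffices to bound it where \<open>a, b, c\<close> are signs \<open>e, f, g\<close>; there it factors as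
  \<open>(1 - f g a') (1 - e g b') (1 - e f c')\<close>.
\<close>

lemma triangles_le_quadrilaterals:
  fixes a b c a' b' c' :: real
  assumes "\<bar>a\<bar> \<le> 1" "\<bar>b\<bar> \<le> 1" "\<bar>c\<bar> \<le> 1" "\<bar>a'\<bar> \<le> 1" "\<bar>b'\<bar> \<le> 1" "\<bar>c'\<bar> \<le> 1"
  shows "a * b * c' + a * b' * c + a' * b * c + a' * b' * c'
      \<le> 1 + a * a' * b * b' + b * b' * c * c' + a * a' * c * c'"
proof -
  define F where "F = (\<lambda>a b c. 1 + a * a' * b * b' + b * b' * c * c' + a * a' * c * c'
    - (a * b * c' + a * b' * c + a' * b * c + a' * b' * c'))"
  have vertex: "0 \<le> F e f g" if "e \<in> {1, -1}" "f \<in> {1, -1}" "g \<in> {1, -1}" for e f g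
  proof -
    have "0 \<le> (1 - f * g * a') * (1 - e * g * b') * (1 - e * f * c')"
      using that assms(4-6) by (intro mult_nonneg_nonneg) (auto simp: abs_le_iff)
    also have "\<dots> = F e f g"
      using that unfolding F_def by (elim insertE emptyE) (simp_all add: algebra_simps)
    finally show ?thesis .
  qed
  have affine: "0 \<le> h x" if "\<bar>x\<bar> \<le> 1" "\<And>x. h x = ((1 + x) * h 1 + (1 - x) * h (-1)) / 2" "0 \<le> h 1" "0 \<le> h (-1)"
    for h :: "real \<Rightarrow> real" and x
    using that(1,3,4) by (subst that(2)) (auto simp: abs_le_iff)
  have F: "F e f x = ((1 + x) * F e f 1 + (1 - x) * F e f (-1)) / 2"
    "F e x g = ((1 + x) * F e 1 g + (1 - x) * F e (-1) g) / 2"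
    "F x f g = ((1 + x) * F 1 f g + (1 - x) * F (-1) f g) / 2" for e f g x
    by (simp_all add: F_def field_simps)
  have c: "0 \<le> F e f c" if "e \<in> {1, -1}" "f \<in> {1, -1}" for e f
    using assms(3) by (rule affine) (rule F vertex that insertI1 insertI2)+
  have bc: "0 \<le> F e b c" if "e \<in> {1, -1}" for e
    using assms(2) by (rule affine) (rule F c that insertI1 insertI2)+
  have "0 \<le> F a b c"
    using assms(1) by (rule affine) (rule F bc insertI1 insertI2)+
  then show ?thesis
    by (simp add: F_def)
qed

abbreviation principal_minor_2 :: "real^'n^'n \<Rightarrow> 'n \<Rightarrow> 'n \<Rightarrow> real" where
  "principal_minor_2 X i j \<equiv> X$i$i * X$j$j - (X$i$j)\<^sup>2"

lemma S42_symD: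
  assumes "X \<in> S42"
  shows "X$j$i = X$i$j"
proof -
  have "transpose X = X"
    using assms by (simp add: S42_iff)
  from arg_cong[OF this, of "\<lambda>M. M$i$j"] show ?thesis
    by (simp add: transpose_def)
qed

lemma S42_diag_nonneg: "X \<in> S42 \<Longrightarrow> 0 \<le> X$i$i"
  and S42_minor_nonneg: "X \<in> S42 \<Longrightarrow> 0 \<le> principal_minor_2 X i j"
  by (simp_all add: S42_iff)

text \<open>
  The analogue of passing from a covariance matrix to a correlation matrix. A vanishing diagonal entry
  forces its row to vanish, so the normalized entries can be taken to be \<open>0\<close> there.
\<close>

lemma S42_normalize:
  assumes X: "X \<in> S42"
  obtains d :: "4 \<Rightarrow> real" and y :: "4 \<Rightarrow> 4 \<Rightarrow> real"
  where "\<And>i. 0 \<le> d i" "\<And>i j. X$i$j = d i * d j * y i j" "\<And>i. X$i$i = (d i)\<^sup>2" "\<And>i j. \<bar>y i j\<bar> \<le> 1"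
proof
  define d where "d i = sqrt (X$i$i)" for i
  define y where "y i j = X$i$j / (d i * d j)" for i j
  have sq: "X$i$i = (d i)\<^sup>2" for i
    using S42_diag_nonneg[OF X] by (simp add: d_def)
  show "0 \<le> d i" for i
    using S42_diag_nonneg[OF X] by (simp add: d_def)
  have le: "\<bar>X$i$j\<bar> \<le> d i * d j" for i j
    using real_sqrt_le_mono[of "(X$i$j)\<^sup>2"] S42_minor_nonneg[OF X, of i j]
    by (simp add: d_def flip: real_sqrt_mult)
  show "X$i$j = d i * d j * y i j" for i j
    using le[of i j] by (auto simp: y_def)
  show "\<bar>y i j\<bar> \<le> 1" for i j
  proof (cases "d i * d j = 0")
    case False
    then have "0 < d i * d j"
      using le[of i j] abs_ge_zero[of "X$i$j"] by linarith
    then show ?thesis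
      using le[of i j] by (simp only: y_def abs_divide abs_of_pos divide_le_eq_1_pos)
  qed (auto simp: y_def)
  show "X$i$i = (d i)\<^sup>2" for i
    by (rule sq)
qed

text \<open>
  The three products are indexed by the ways to split the four indices into two pairs. In the difference of the
  two sides only the product of the diagonal entries, the four-cycles and the triangles survive, and after
  normalization it is a nonnegative multiple of the difference in \<open>triangles_le_quadrilaterals\<close>.
\<close>

lemma S42_det_le:
  assumes X: "X \<in> S42"
  shows "det X \<le> principal_minor_2 X 1 2 * principal_minor_2 X 3 4
    + principal_minor_2 X 1 3 * principal_minor_2 X 2 4
    + principal_minor_2 X 1 4 * principal_minor_2 X 2 3" (is "_ \<le> ?R")
proof -
  obtain d y where d: "\<And>i. 0 \<le> d i" and y: "\<And>i j. X$i$j = d i * d j * y i j" "\<And>i j. \<bar>y i j\<bar> \<le> 1"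
    and dd: "\<And>i. X$i$i = (d i)\<^sup>2"
    by (rule S42_normalize[OF X]) blast
  define F where "F = 1 + y 1 2 * y 3 4 * y 1 3 * y 2 4 + y 1 3 * y 2 4 * y 1 4 * y 2 3
      + y 1 2 * y 3 4 * y 1 4 * y 2 3
    - (y 1 2 * y 1 3 * y 2 3 + y 1 2 * y 2 4 * y 1 4 + y 3 4 * y 1 3 * y 1 4 + y 3 4 * y 2 4 * y 2 3)"
  have "?R - det X = 2 * (X$1$1 * X$2$2 * X$3$3 * X$4$4
      + X$1$2 * X$3$4 * X$1$3 * X$2$4 + X$1$3 * X$2$4 * X$1$4 * X$2$3 + X$1$2 * X$3$4 * X$1$4 * X$2$3
      - (X$4$4 * X$1$2 * X$1$3 * X$2$3 + X$3$3 * X$1$2 * X$2$4 * X$1$4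
         + X$2$2 * X$3$4 * X$1$3 * X$1$4 + X$1$1 * X$3$4 * X$2$4 * X$2$3))"
    unfolding det_4 S42_symD[OF X, of 1 2] S42_symD[OF X, of 1 3] S42_symD[OF X, of 1 4]
      S42_symD[OF X, of 2 3] S42_symD[OF X, of 2 4] S42_symD[OF X, of 3 4]
    by (simp add: algebra_simps power2_eq_square)
  also have "\<dots> = 2 * (d 1 * d 2 * d 3 * d 4)\<^sup>2 * F"
    unfolding F_def dd y(1)[of 1 2] y(1)[of 1 3] y(1)[of 1 4] y(1)[of 2 3] y(1)[of 2 4] y(1)[of 3 4]
    by (simp add: algebra_simps power2_eq_square)
  also have "\<dots> \<ge> 0"
    using triangles_le_quadrilaterals[of "y 1 2" "y 1 3" "y 1 4" "y 3 4" "y 2 4" "y 2 3"] y(2)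
    by (intro mult_nonneg_nonneg) (simp_all add: F_def)
  finally show ?thesis by simp
qed

text \<open>
  Individual principal minors change under similarity, but traces of powers do not, so the second
  symmetric function is obtained from Newton's identity.
\<close>

lemma elem_sym_spectrum:
  fixes X :: "real^4^4"
  assumes "similar_matrices X (diag v)"
  shows "elem_sym 1 v = trace X" "2 * elem_sym 2 v = (trace X)\<^sup>2 - trace (X ** X)" "elem_sym 4 v = det X"
proof -
  obtain P where P: "invertible P" and X: "X = P ** diag v ** matrix_inv P"
    using assms by (auto simp: similar_matrices_def)
  have I: "matrix_inv P ** P = mat 1" "P ** matrix_inv P = mat 1"
    using P someI_ex[of "\<lambda>A'. P ** A' = mat 1 \<and> A' ** P = mat 1"]
    by (auto simp: invertible_def matrix_inv_def)
  have tr: "trace (P ** D ** matrix_inv P) = trace D" for D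
    by (metis I(1) matrix_mul_assoc matrix_mul_lid trace_mul_sym)
  have "X ** X = P ** (diag v ** diag v) ** matrix_inv P"
  proof -
    have "X ** X = P ** diag v ** (matrix_inv P ** P) ** diag v ** matrix_inv P"
      by (simp add: X matrix_mul_assoc)
    then show ?thesis
      by (simp add: I matrix_mul_assoc)
  qed
  moreover have "diag v ** diag v = diag (\<chi> i. (v$i)\<^sup>2)"
  proof -
    have "(diag v ** diag v)$i$j = (\<Sum>k\<in>UNIV. if k = i then diag (\<chi> i. (v$i)\<^sup>2)$i$j else 0)" for i j
      unfolding matrix_matrix_mult_def vec_lambda_beta
      by (rule sum.cong) (auto simp: diag_def power2_eq_square)
    then show ?thesis
      by (simp add: vec_eq_iff)
  qed
  ultimately have "trace (X ** X) = trace (diag (\<chi> i. (v$i)\<^sup>2))"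
    by (simp only: tr)
  then have tr2: "trace (X ** X) = (\<Sum>i\<in>UNIV. (v$i)\<^sup>2)"
    by (simp add: trace_def diag_def)
  have tr1: "trace X = (\<Sum>i\<in>UNIV. v$i)"
    unfolding X tr by (simp add: trace_def diag_def)
  have "det P * det (matrix_inv P) = 1"
    by (metis I(2) det_I det_mul)
  then have "det X = (\<Prod>i\<in>UNIV. v$i)"
    unfolding X by (simp add: det_mul det_diag)
  then show "elem_sym 4 v = det X"
    unfolding elem_sym_4 prod_4 by (rule sym)
  show "elem_sym 1 v = trace X"
    by (simp only: elem_sym_4 tr1 sum_4)
  show "2 * elem_sym 2 v = (trace X)\<^sup>2 - trace (X ** X)"
    unfolding tr1 tr2 sum_4 elem_sym_4 by (simp add: algebra_simps power2_eq_square)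
qed

text \<open>
  Here \<open>e\<^sub>2\<close> is the sum of the six principal minors of size two. Group them into the three complementary pairs:
  the square of the sum is at least the sum of the squares of the pair sums, each of these is at least four times
  the product of the pair, and the three products dominate \<open>e\<^sub>4\<close> by \<open>S42_det_le\<close>.
\<close>

lemma S42_spectrum_inequalities:
  assumes "v \<in> spectra S42"
  shows "elem_sym 1 v \<ge> 0" "elem_sym 2 v \<ge> 0" "(elem_sym 2 v)\<^sup>2 \<ge> 4 * elem_sym 4 v"
proof -
  obtain X where X: "X \<in> S42" and sim: "similar_matrices X (diag v)"
    using assms by (auto simp: spectra_def)
  note e = elem_sym_spectrum[OF sim]
  let ?m = "principal_minor_2 X"
  have "2 * elem_sym 2 v = 2 * ((?m 1 2 + ?m 3 4) + (?m 1 3 + ?m 2 4) + (?m 1 4 + ?m 2 3))"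
    unfolding e trace_def matrix_matrix_mult_def
    by (simp add: sum_4 S42_symD[OF X, of 1 2] S42_symD[OF X, of 1 3] S42_symD[OF X, of 1 4]
      S42_symD[OF X, of 2 3] S42_symD[OF X, of 2 4] S42_symD[OF X, of 3 4] algebra_simps power2_eq_square)
  then have e2: "elem_sym 2 v = (?m 1 2 + ?m 3 4) + (?m 1 3 + ?m 2 4) + (?m 1 4 + ?m 2 3)"
    by simp
  show "elem_sym 1 v \<ge> 0"
    unfolding e trace_def using S42_diag_nonneg[OF X] by (rule sum_nonneg)
  show "elem_sym 2 v \<ge> 0"
    unfolding e2 by (intro add_nonneg_nonneg S42_minor_nonneg[OF X])
  have amgm: "4 * (p * q) \<le> (p + q)\<^sup>2" for p q :: real
    using zero_le_power2[of "p - q"] by (simp add: power2_eq_square algebra_simps)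
  have sq: "p\<^sup>2 + q\<^sup>2 + r\<^sup>2 \<le> (p + q + r)\<^sup>2" if "0 \<le> p" "0 \<le> q" "0 \<le> r" for p q r :: real
    using mult_nonneg_nonneg[OF that(1,2)] mult_nonneg_nonneg[OF that(1,3)] mult_nonneg_nonneg[OF that(2,3)]
    by (simp add: power2_eq_square algebra_simps)
  have "4 * det X \<le> 4 * (?m 1 2 * ?m 3 4) + 4 * (?m 1 3 * ?m 2 4) + 4 * (?m 1 4 * ?m 2 3)"
    using S42_det_le[OF X] by linarith
  also have "\<dots> \<le> (?m 1 2 + ?m 3 4)\<^sup>2 + (?m 1 3 + ?m 2 4)\<^sup>2 + (?m 1 4 + ?m 2 3)\<^sup>2"
    by (intro add_mono amgm)
  also have "\<dots> \<le> (elem_sym 2 v)\<^sup>2"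
    unfolding e2 by (intro sq add_nonneg_nonneg S42_minor_nonneg[OF X])
  finally show "(elem_sym 2 v)\<^sup>2 \<ge> 4 * elem_sym 4 v"
    by (simp add: e)
qed

section \<open>Realizable spectra\<close>

text \<open>
  Stated with a characteristic polynomial, realizability of a spectrum is visibly symmetric in the four
  numbers and can be checked by expanding a determinant.
\<close>

definition S42_char_roots :: "real \<Rightarrow> real \<Rightarrow> real \<Rightarrow> real \<Rightarrow> bool" where
  "S42_char_roots a b c d \<longleftrightarrow> (\<exists>X\<in>S42. \<forall>x. det (mat x - X) = (x - a) * (x - b) * (x - c) * (x - d))"

lemma S42_char_rootsE:
  assumes "S42_char_roots (v$1) (v$2) (v$3) (v$4)"
  obtains Q where "orthogonal_matrix Q" "Q ** diag v ** transpose Q \<in> S42"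
proof -
  obtain X where X: "X \<in> S42" and
    ch: "\<And>x. det (mat x - X) = (x - v$1) * (x - v$2) * (x - v$3) * (x - v$4)"
    using assms unfolding S42_char_roots_def by blast
  obtain Q where "orthogonal_matrix Q" "X = Q ** diag v ** transpose Q"
    using char_poly_splits_imp_orthogonally_similar[of X v] X ch by (auto simp: S42_iff prod_4)
  then show thesis
    using that X by metis
qed

lemma S42_char_roots_imp_spectra:
  assumes "S42_char_roots (v$1) (v$2) (v$3) (v$4)"
  shows "v \<in> spectra S42"
proof -
  obtain Q where Q: "orthogonal_matrix Q" and X: "Q ** diag v ** transpose Q \<in> S42"
    by (rule S42_char_rootsE[OF assms])
  have inv: "invertible Q"
    using Q by (auto simp: invertible_def orthogonal_matrix_def)
  then have "Q ** matrix_inv Q = mat 1"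
    using someI_ex[of "\<lambda>A'. Q ** A' = mat 1 \<and> A' ** Q = mat 1"]
    by (auto simp: invertible_def matrix_inv_def)
  then have "matrix_inv Q = transpose Q"
    using Q by (metis matrix_mul_assoc matrix_mul_lid matrix_mul_rid orthogonal_matrix_def)
  then show ?thesis
    unfolding spectra_def similar_matrices_def
    using inv by (intro CollectI bexI[OF _ X] exI[of _ Q]) simp
qed

text \<open>
  Adding a positive semidefinite matrix keeps all principal submatrices positive semidefinite; on the entries,
  the cross term in the new minor is \<open>r\<close> times a value of the old quadratic form.
\<close>

lemma S42_add_rank_one:
  assumes X: "X \<in> S42" and r: "0 \<le> r" and Y: "\<And>i j. Y$i$j = X$i$j + r * q i * q j"
  shows "Y \<in> S42"
  unfolding S42_iff
proof (intro conjI allI)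
  show "transpose Y = Y"
    by (simp add: vec_eq_iff transpose_def Y S42_symD[OF X] mult.commute mult.left_commute)
  show "0 \<le> Y$i$i" for i
    using S42_diag_nonneg[OF X] r by (simp add: Y mult.assoc)
  show "(Y$i$j)\<^sup>2 \<le> Y$i$i * Y$j$j" for i j
  proof -
    have "\<forall>x y. 0 \<le> X$i$i * x\<^sup>2 + 2 * X$i$j * x * y + X$j$j * y\<^sup>2"
      unfolding quadratic_form_2_nonneg_iff
      using S42_diag_nonneg[OF X] S42_minor_nonneg[OF X, of i j] by simp
    from this[rule_format, of "q j" "- q i"]
    have "0 \<le> X$i$i * (q j)\<^sup>2 - 2 * X$i$j * q i * q j + X$j$j * (q i)\<^sup>2"
      by (simp add: mult_ac)
    then have "0 \<le> r * (X$i$i * (q j)\<^sup>2 - 2 * X$i$j * q i * q j + X$j$j * (q i)\<^sup>2)"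
      using r by (rule mult_nonneg_nonneg[rotated])
    moreover have "Y$i$i * Y$j$j - (Y$i$j)\<^sup>2 = (X$i$i * X$j$j - (X$i$j)\<^sup>2)
        + r * (X$i$i * (q j)\<^sup>2 - 2 * X$i$j * q i * q j + X$j$j * (q i)\<^sup>2)"
      by (simp add: Y power2_eq_square algebra_simps)
    ultimately show ?thesis
      using S42_minor_nonneg[OF X, of i j] by linarith
  qed
qed

text \<open>
  Raising one eigenvalue adds a positive multiple of the projection to its eigenvector. This reduces
  realizability to spectra that are as low as possible.
\<close>

lemma S42_char_roots_mono:
  assumes "S42_char_roots a b c d" "d \<le> d'"
  shows "S42_char_roots a b c d'"
proof -
  define v where "v = (vector [a, b, c, d] :: real^4)"
  define w where "w = (vector [a, b, c, d'] :: real^4)"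
  have v: "v$1 = a" "v$2 = b" "v$3 = c" "v$4 = d" and w: "w$1 = a" "w$2 = b" "w$3 = c" "w$4 = d'"
    by (simp_all add: v_def w_def)
  obtain Q where Q: "orthogonal_matrix Q" and X: "Q ** diag v ** transpose Q \<in> S42"
    using S42_char_rootsE[of v] assms(1) unfolding v by blast
  \<comment> \<open>the two matrices differ by \<open>d' - d\<close> times the rank-one matrix \<open>q q\<^sup>T\<close> of the fourth column \<open>q\<close> of \<open>Q\<close>\<close>
  have ent: "(Q ** diag u ** transpose Q)$i$j = (\<Sum>k\<in>UNIV. Q$i$k * u$k * Q$j$k)" for i j and u :: "real^4"
    by (simp add: matrix_matrix_mult_def transpose_def diag_def if_distrib cong: if_cong)
  have "Q ** diag w ** transpose Q \<in> S42"
    using assms(2) by (intro S42_add_rank_one[OF X, of "d' - d" _ "\<lambda>i. Q$i$4"])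
      (simp_all add: ent sum_4 v w algebra_simps)
  moreover have "det (mat x - Q ** diag w ** transpose Q) = (x - a) * (x - b) * (x - c) * (x - d')" for x
    by (simp add: char_poly_orthogonal_conj_diag[OF Q] prod_4 w)
  ultimately show ?thesis
    unfolding S42_char_roots_def by blast
qed

section \<open>Construction of matrices\<close>

definition sym_matrix_4 ::
  "real \<Rightarrow> real \<Rightarrow> real \<Rightarrow> real \<Rightarrow> real \<Rightarrow> real \<Rightarrow> real \<Rightarrow> real \<Rightarrow> real \<Rightarrow> real \<Rightarrow> real^4^4" where
  "sym_matrix_4 x11 x12 x13 x14 x22 x23 x24 x33 x34 x44 =
     vector [vector [x11, x12, x13, x14], vector [x12, x22, x23, x24],
             vector [x13, x23, x33, x34], vector [x14, x24, x34, x44]]"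

lemma sym_matrix_4_in_S42:
  assumes "0 \<le> x11" "0 \<le> x22" "0 \<le> x33" "0 \<le> x44"
    "x12\<^sup>2 \<le> x11 * x22" "x13\<^sup>2 \<le> x11 * x33" "x14\<^sup>2 \<le> x11 * x44"
    "x23\<^sup>2 \<le> x22 * x33" "x24\<^sup>2 \<le> x22 * x44" "x34\<^sup>2 \<le> x33 * x44"
  shows "sym_matrix_4 x11 x12 x13 x14 x22 x23 x24 x33 x34 x44 \<in> S42"
  using assms unfolding S42_iff
  by (simp add: forall_4 sym_matrix_4_def vec_eq_iff transpose_def mult.commute power2_eq_square)

lemma S42_char_roots_nonneg:
  assumes "0 \<le> a" "0 \<le> b" "0 \<le> c" "0 \<le> d"
  shows "S42_char_roots a b c d"
  unfolding S42_char_roots_def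
proof (intro bexI allI)
  show "sym_matrix_4 a 0 0 0 b 0 0 c 0 d \<in> S42"
    using assms by (intro sym_matrix_4_in_S42) auto
qed (simp add: det_4 sym_matrix_4_def mat_def)

text \<open>
  The matrix is block diagonal with respect to the orthonormal basis made of the first two coordinate
  vectors and \<open>(0,0,1,1)/\<surd>2\<close>, \<open>(0,0,-1,1)/\<surd>2\<close>. One block has diagonal \<open>w, s\<close> and eigenvalues \<open>a, -c\<close>, the
  other has diagonal \<open>w', r\<close> and eigenvalues \<open>b, -d\<close>. Writing \<open>g\<close> and \<open>h\<close> for the off-diagonal entries
  divided by \<open>\<surd>2\<close>, the minors are nonnegative as soon as \<open>a c \<le> w r\<close> and \<open>b d \<le> w' s\<close>. If the traces
  \<open>a - c\<close> and \<open>b - d\<close> are divided in the ratio \<open>p : q\<close>, in opposite orders in the two blocks,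
  both conditions follow from the hypothesis on \<open>(p + q)\<^sup>2\<close>.
\<close>

lemma S42_char_roots_two_negative:
  assumes pq: "0 \<le> p" "0 \<le> q" "0 < p + q" and p: "p\<^sup>2 = a * c" and q: "q\<^sup>2 = b * d"
    and le: "c \<le> a" "d \<le> b" "(p + q)\<^sup>2 \<le> (a - c) * (b - d)"
  shows "S42_char_roots a b (-c) (-d)"
proof -
  define \<theta> where "\<theta> = p / (p + q)"
  define \<phi> where "\<phi> = q / (p + q)"
  have \<theta>: "0 \<le> \<theta>" "0 \<le> \<phi>" "\<theta> + \<phi> = 1" "p = \<theta> * (p + q)" "q = \<phi> * (p + q)"
    using pq by (auto simp: \<theta>_def \<phi>_def simp flip: add_divide_distrib)
  define w where "w = \<theta> * (a - c)"
  define s where "s = \<phi> * (a - c)"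
  define w' where "w' = \<phi> * (b - d)"
  define r where "r = \<theta> * (b - d)"
  have nn: "0 \<le> w" "0 \<le> s" "0 \<le> w'" "0 \<le> r"
    using \<theta> le by (simp_all add: w_def s_def w'_def r_def)
  have tr: "w + s = a - c" "w' + r = b - d"
    using \<theta>(3) unfolding w_def s_def w'_def r_def by (metis add.commute distrib_right mult_1)+
  have pw: "p\<^sup>2 \<le> w * r"
  proof -
    have "p\<^sup>2 = \<theta>\<^sup>2 * (p + q)\<^sup>2" by (subst \<theta>(4)) (simp add: power_mult_distrib)
    also have "\<dots> \<le> \<theta>\<^sup>2 * ((a - c) * (b - d))" using le by (intro mult_left_mono) auto
    finally show ?thesis by (simp add: w_def r_def power2_eq_square mult_ac)
  qed
  have qw: "q\<^sup>2 \<le> w' * s"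
  proof -
    have "q\<^sup>2 = \<phi>\<^sup>2 * (p + q)\<^sup>2" by (subst \<theta>(5)) (simp add: power_mult_distrib)
    also have "\<dots> \<le> \<phi>\<^sup>2 * ((a - c) * (b - d))" using le by (intro mult_left_mono) auto
    finally show ?thesis by (simp add: w'_def s_def power2_eq_square mult_ac)
  qed
  define g where "g = sqrt ((w * s + p\<^sup>2) / 2)"
  define h where "h = sqrt ((w' * r + q\<^sup>2) / 2)"
  have g: "2 * g\<^sup>2 = w * s + p\<^sup>2" and h: "2 * h\<^sup>2 = w' * r + q\<^sup>2"
    using nn by (simp_all add: g_def h_def)
  let ?X = "sym_matrix_4 w 0 g g w' (-h) h ((s + r) / 2) ((s - r) / 2) ((s + r) / 2)"
  have "?X \<in> S42"
  proof (rule sym_matrix_4_in_S42)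
    have "2 * g\<^sup>2 \<le> w * (s + r)" "2 * h\<^sup>2 \<le> w' * (s + r)"
      unfolding g h using pw qw by (simp_all add: algebra_simps)
    then show "g\<^sup>2 \<le> w * ((s + r) / 2)" "g\<^sup>2 \<le> w * ((s + r) / 2)"
      "(- h)\<^sup>2 \<le> w' * ((s + r) / 2)" "h\<^sup>2 \<le> w' * ((s + r) / 2)"
      by simp_all
    show "((s - r) / 2)\<^sup>2 \<le> (s + r) / 2 * ((s + r) / 2)"
      using mult_nonneg_nonneg[OF nn(2,4)] by (simp add: power2_eq_square algebra_simps)
  qed (use nn in auto)
  moreover have "det (mat x - ?X) = (x - a) * (x - b) * (x - - c) * (x - - d)" for x
  proof -
    have "det (mat x - ?X) = ((x - w) * (x - s) - 2 * g\<^sup>2) * ((x - w') * (x - r) - 2 * h\<^sup>2)"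
      by (simp add: det_4 sym_matrix_4_def mat_def power2_eq_square field_simps)
    also have "(x - w) * (x - s) - 2 * g\<^sup>2 = x\<^sup>2 - (w + s) * x - p\<^sup>2"
      unfolding g by (simp add: algebra_simps power2_eq_square)
    also have "\<dots> = (x - a) * (x + c)"
      unfolding tr p by (simp add: algebra_simps power2_eq_square)
    also have "(x - w') * (x - r) - 2 * h\<^sup>2 = x\<^sup>2 - (w' + r) * x - q\<^sup>2"
      unfolding h by (simp add: algebra_simps power2_eq_square)
    also have "\<dots> = (x - b) * (x + d)"
      unfolding tr q by (simp add: algebra_simps power2_eq_square)
    finally show ?thesis by (simp add: mult_ac)
  qed
  ultimately show ?thesis
    unfolding S42_char_roots_def by blast
qed

text \<open>
  The hypothesis says \<open>e\<^sub>2 = 0\<close>, which forces all principal minors of size two to vanish. The matrices used have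
  diagonal entries \<open>v\<^sub>i\<^sup>2\<close> and off-diagonal entries \<open>- v\<^sub>i v\<^sub>j\<close>. Choosing \<open>v\<^sub>1 = v\<^sub>2 = t\<close> makes \<open>(1,-1,0,0)\<close>
  an eigenvector for \<open>2 t\<^sup>2\<close>, which is set equal to the middle eigenvalue \<open>b\<close>. The remaining cubic factor prescribes
  \<open>p\<^sup>2 + q\<^sup>2 = a + c - d\<close> and \<open>4 b p\<^sup>2 q\<^sup>2 = a c d\<close>. These have a real solution because \<open>c \<le> d \<le> a\<close>: up to
  a positive factor, the discriminant of the quadratic equation for \<open>p\<^sup>2\<close> and \<open>q\<^sup>2\<close> is \<open>(a + c) (a - d) (d - c)\<close>.
\<close>

lemma S42_char_roots_one_negative_extreme:
  assumes ord: "b \<le> a" "c \<le> b" "0 \<le> c" "0 < b" and e2: "a * b + a * c + b * c = d * (a + b + c)"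
  shows "S42_char_roots a b c (-d)"
proof -
  have "c * (a + b + c) \<le> d * (a + b + c)"
    unfolding e2[symmetric] using mult_mono[of c a c b] ord by (simp add: algebra_simps)
  then have cd: "c \<le> d" using ord by simp
  have "d * (a + b + c) \<le> a * (a + b + c)"
    unfolding e2[symmetric] using mult_mono[of b a c a] ord by (simp add: algebra_simps)
  then have da: "d \<le> a" using ord by simp
  define T where "T = a + c - d"
  \<comment> \<open>\<open>D\<close> is the discriminant of \<open>y\<^sup>2 - T y + a c d / (4 b)\<close>, whose roots are \<open>p\<^sup>2\<close> and \<open>q\<^sup>2\<close>\<close>
  define D where "D = T\<^sup>2 - a * c * d / b"
  have T: "0 \<le> T" using da ord by (simp add: T_def)
  have bT: "b * T = d * (a + c) - a * c"
    using e2 by (simp add: T_def algebra_simps)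
  have "b * D = b * T * T - a * c * d"
    using ord by (simp add: D_def power2_eq_square algebra_simps)
  also have "\<dots> = (a + c) * ((a - d) * (d - c))"
    unfolding bT unfolding T_def by (simp add: algebra_simps)
  also have "\<dots> \<ge> 0"
    using ord cd da by simp
  finally have D: "0 \<le> D" using ord by (simp add: zero_le_mult_iff)
  have "0 \<le> a * c * d / b" using ord cd by simp
  then have "sqrt D \<le> T"
    using T by (intro real_le_lsqrt) (simp_all add: D_def)
  define t where "t = sqrt (b / 2)"
  define p where "p = sqrt ((T + sqrt D) / 2)"
  define q where "q = sqrt ((T - sqrt D) / 2)"
  have t2: "t\<^sup>2 = b / 2" and p2: "p\<^sup>2 = (T + sqrt D) / 2" and q2: "q\<^sup>2 = (T - sqrt D) / 2"
    using ord T D \<open>sqrt D \<le> T\<close> by (simp_all add: t_def p_def q_def)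
  have sum: "p\<^sup>2 + q\<^sup>2 = T"
    by (simp add: p2 q2 field_simps)
  have "4 * (p\<^sup>2 * q\<^sup>2) = T\<^sup>2 - (sqrt D)\<^sup>2"
    unfolding p2 q2 by (simp add: power2_eq_square field_simps)
  then have prod: "4 * b * (p\<^sup>2 * q\<^sup>2) = a * c * d"
    using ord D by (simp add: D_def field_simps)
  let ?X = "sym_matrix_4 (t\<^sup>2) (- (t * t)) (- (t * p)) (- (t * q)) (t\<^sup>2) (- (t * p)) (- (t * q))
    (p\<^sup>2) (- (p * q)) (q\<^sup>2)"
  have "?X \<in> S42"
    by (rule sym_matrix_4_in_S42) (simp_all add: power_mult_distrib power2_eq_square)
  moreover have "det (mat x - ?X) = (x - a) * (x - b) * (x - c) * (x - - d)" for x
  proof -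
    have "det (mat x - ?X) = (x - 2 * t\<^sup>2) *
        (x ^ 3 - (p\<^sup>2 + q\<^sup>2) * x\<^sup>2 - 2 * t\<^sup>2 * (p\<^sup>2 + q\<^sup>2) * x + 4 * (2 * t\<^sup>2) * (p\<^sup>2 * q\<^sup>2))"
      by (simp add: det_4 sym_matrix_4_def mat_def) algebra
    also have "2 * t\<^sup>2 = b"
      by (simp add: t2)
    also have "x ^ 3 - (p\<^sup>2 + q\<^sup>2) * x\<^sup>2 - b * (p\<^sup>2 + q\<^sup>2) * x + 4 * b * (p\<^sup>2 * q\<^sup>2)
        = (x - a) * (x - c) * (x + d)"
      unfolding sum prod bT by (simp add: T_def algebra_simps power2_eq_square power3_eq_cube)
    finally show ?thesis by (simp add: mult_ac)
  qed
  ultimately show ?thesis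
    unfolding S42_char_roots_def by blast
qed

text \<open>
  Sorted spectra satisfying the inequalities have at most two negative entries, since three negative entries and
  a nonnegative sum make \<open>e\<^sub>2\<close> negative. A single negative entry can be lowered until \<open>e\<^sub>2 = 0\<close>. If there are two,
  \<open>p\<^sup>2 = - a c\<close> and \<open>q\<^sup>2 = - b d\<close> turn the condition on \<open>e\<^sub>2\<^sup>2\<close> into \<open>2 p q \<le> e\<^sub>2\<close>, and
  \<open>(a + c) (b + d) = e\<^sub>2 + p\<^sup>2 + q\<^sup>2\<close> is then at least \<open>(p + q)\<^sup>2\<close>.
\<close>

lemma S42_char_roots_sorted:
  assumes ord: "b \<le> a" "c \<le> b" "d \<le> c"
    and e1: "0 \<le> a + b + c + d" and e2: "0 \<le> a*b + a*c + a*d + b*c + b*d + c*d"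
    and e4: "4 * (a*b*c*d) \<le> (a*b + a*c + a*d + b*c + b*d + c*d)\<^sup>2"
  shows "S42_char_roots a b c d"
proof -
  consider "0 \<le> d" | "d < 0" "0 \<le> c" | "c < 0"
    by linarith
  then show ?thesis
  proof cases
    case 1
    then show ?thesis using ord by (intro S42_char_roots_nonneg) auto
  next
    case 2
    have s: "0 < a + b + c" using e1 2 by linarith
    have e2': "- d * (a + b + c) \<le> a * b + a * c + b * c"
      using e2 by (simp add: algebra_simps)
    have "0 < b"
    proof (rule ccontr)
      assume "\<not> 0 < b"
      then have "b = 0" "c = 0" using ord 2 by auto
      then show False
        using e2' s 2 mult_neg_pos[of d a] by simp
    qed
    \<comment> \<open>the eigenvalue \<open>- d0\<close> in place of \<open>d\<close> would make \<open>e\<^sub>2\<close> vanish\<close>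
    define d0 where "d0 = (a * b + a * c + b * c) / (a + b + c)"
    have "S42_char_roots a b c (- d0)"
      using ord 2 \<open>0 < b\<close> s by (intro S42_char_roots_one_negative_extreme) (simp_all add: d0_def)
    moreover have "- d0 \<le> d"
      using e2' s by (simp add: d0_def field_simps)
    ultimately show ?thesis
      by (rule S42_char_roots_mono)
  next
    case 3
    then have d: "d < 0" using ord by simp
    have b: "0 \<le> b"
    proof (rule ccontr)
      assume b: "\<not> 0 \<le> b"
      have "0 \<le> (a + b + c + d) * (- (b + c + d))"
        using e1 b 3 d by (intro mult_nonneg_nonneg) auto
      moreover have "0 < b * c + b * d + c * d"
        using b 3 d by (intro add_pos_pos mult_neg_neg) auto
      moreover have "0 \<le> b\<^sup>2 + c\<^sup>2 + d\<^sup>2" by simp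
      moreover have "(a + b + c + d) * (- (b + c + d)) + (a*b + a*c + a*d + b*c + b*d + c*d)
          = - (b\<^sup>2 + c\<^sup>2 + d\<^sup>2) - (b * c + b * d + c * d)"
        by (simp add: algebra_simps power2_eq_square)
      ultimately show False
        using e2 by linarith
    qed
    have a: "0 < a" using e1 ord 3 d by linarith
    define p where "p = sqrt (a * - c)"
    define q where "q = sqrt (b * - d)"
    have nn: "0 < a * - c" "0 \<le> b * - d"
      using a b 3 d by (simp_all only: mult_pos_pos mult_nonneg_nonneg neg_0_less_iff_less neg_0_le_iff_le less_imp_le)
    have p: "0 < p" "p\<^sup>2 = a * - c" and q: "0 \<le> q" "q\<^sup>2 = b * - d"
      using nn by (simp_all only: p_def q_def real_sqrt_gt_zero real_sqrt_ge_zero real_sqrt_pow2 less_imp_le)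
    have "(2 * (p * q))\<^sup>2 = 4 * (a * b * c * d)"
      by (simp add: power_mult_distrib p q)
    then have "(2 * (p * q))\<^sup>2 \<le> (a*b + a*c + a*d + b*c + b*d + c*d)\<^sup>2"
      using e4 by simp
    then have le: "2 * (p * q) \<le> a*b + a*c + a*d + b*c + b*d + c*d"
      using e2 by (rule power2_le_imp_le)
    have "(p + q)\<^sup>2 = p\<^sup>2 + q\<^sup>2 + 2 * (p * q)"
      by (simp add: power2_eq_square algebra_simps)
    also have "\<dots> \<le> a * - c + b * - d + (a*b + a*c + a*d + b*c + b*d + c*d)"
      unfolding p q using le by simp
    also have "\<dots> = (a - - c) * (b - - d)"
      by (simp add: algebra_simps)
    finally have pq: "(p + q)\<^sup>2 \<le> (a - - c) * (b - - d)" .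
    moreover have "0 < (p + q)\<^sup>2" using p q by simp
    ultimately have "0 < (a - - c) * (b - - d)" by linarith
    then have "0 < a - - c" "0 < b - - d"
      using e1 by (auto simp: zero_less_mult_iff)
    then have "S42_char_roots a b (- (- c)) (- (- d))"
      using p q pq by (intro S42_char_roots_two_negative[of p q]) auto
    then show ?thesis by simp
  qed
qed

section \<open>The characterization\<close>

lemma wlog_sorted_4:
  fixes P :: "'a::linorder \<Rightarrow> 'a \<Rightarrow> 'a \<Rightarrow> 'a \<Rightarrow> bool"
  assumes s12: "\<And>a b c d. P a b c d \<Longrightarrow> P b a c d" and s23: "\<And>a b c d. P a b c d \<Longrightarrow> P a c b d"
    and s34: "\<And>a b c d. P a b c d \<Longrightarrow> P a b d c"
    and sorted: "\<And>a b c d. b \<le> a \<Longrightarrow> c \<le> b \<Longrightarrow> d \<le> c \<Longrightarrow> P a b c d"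
  shows "P a b c d"
proof -
  \<comment> \<open>insertion of the last entry into three sorted ones, then of the third into two, by adjacent swaps\<close>
  have 3: "P a b c d" if "b \<le> a" "c \<le> b" for a b c d
  proof -
    consider "d \<le> c" | "c \<le> d" "d \<le> b" | "b \<le> d" "d \<le> a" | "a \<le> d"
      by (meson linear)
    then show ?thesis
      by cases (use that in \<open>blast intro: sorted s12 s23 s34\<close>)+
  qed
  have 2: "P a b c d" if "b \<le> a" for a b c d
  proof -
    consider "c \<le> b" | "b \<le> c" "c \<le> a" | "a \<le> c"
      by (meson linear)
    then show ?thesis
      by cases (use that in \<open>blast intro: 3 s12 s23\<close>)+
  qed
  show ?thesis
    using 2 s12 linear by metis
qed

lemma S42_char_roots_swap:
  "S42_char_roots b a c d \<longleftrightarrow> S42_char_roots a b c d"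
  "S42_char_roots a c b d \<longleftrightarrow> S42_char_roots a b c d"
  "S42_char_roots a b d c \<longleftrightarrow> S42_char_roots a b c d"
  by (simp_all add: S42_char_roots_def mult_ac)

lemma S42_char_roots_if_region:
  assumes "0 \<le> a + b + c + d" "0 \<le> a*b + a*c + a*d + b*c + b*d + c*d"
    "4 * (a*b*c*d) \<le> (a*b + a*c + a*d + b*c + b*d + c*d)\<^sup>2"
  shows "S42_char_roots a b c d"
proof -
  let ?P = "\<lambda>a b c d :: real. 0 \<le> a + b + c + d \<longrightarrow> 0 \<le> a*b + a*c + a*d + b*c + b*d + c*d \<longrightarrow>
    4 * (a*b*c*d) \<le> (a*b + a*c + a*d + b*c + b*d + c*d)\<^sup>2 \<longrightarrow> S42_char_roots a b c d"
  have "?P a b c d"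
  proof (rule wlog_sorted_4[of ?P])
    fix a b c d :: real
    assume P: "?P a b c d"
    show "?P b a c d"
      using P unfolding S42_char_roots_swap(1)[of b a c d] by (simp add: algebra_simps)
    show "?P a c b d"
      using P unfolding S42_char_roots_swap(2)[of a c b d] by (simp add: algebra_simps)
    show "?P a b d c"
      using P unfolding S42_char_roots_swap(3)[of a b d c] by (simp add: algebra_simps)
  qed (blast intro: S42_char_roots_sorted)
  then show ?thesis
    using assms by blast
qed

theorem theorem2p6:
  shows "spectra S42 =
    {v :: real^4. elem_sym 1 v \<ge> 0 \<and> elem_sym 2 v \<ge> 0 \<and> (elem_sym 2 v)\<^sup>2 \<ge> 4 * elem_sym 4 v}"
  (is "_ = ?R")
proof
  show "spectra S42 \<subseteq> ?R"
    using S42_spectrum_inequalities by blast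
  show "?R \<subseteq> spectra S42"
    unfolding elem_sym_4 by (auto intro!: S42_char_roots_imp_spectra S42_char_roots_if_region)
qed

end
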